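(* Let $(V,\nu,\tau,\tau^* )$ be a PNB space in which $\tau$ and $\tau^*$ are sup-continuous, and let $W$ be a closed linear subspace of $V$ (closed in the strong topology). Then $(V/\!\sim_W,\bar\nu,\tau,\tau^* )$ is also a PNB space.
   Context: Linear spaces are real. $\Delta^+$ is the set of functions $F:\mathbb{R}\cup\{-\infty,+\infty\}\to[0,1]$ that are non-decreasing, left-continuous on $\mathbb{R}$, with $F(-\infty)=F(0)=0$ and $F(+\infty)=1$; it is ordered pointwise. $\varepsilon_0\in\Delta^+$ is given by $\varepsilon_0(x)=0$ for $x\le 0$ and $\varepsilon_0(x)=1$ for $x>0$. $\Delta^+$ carries the Sibley metric $d_S(F,G)=\inf\{h>0: (F,G;h)\text{ and }(G,F;h)\text{ hold}\}$, where, for $h\in(0,1]$, $(F,G;h)$ is the condition $F(x-h)-h\le G(x)\le F(x+h)+h$ for all $x\in(-1/h,1/h)$. A triangle function is an associative, commutative binary operation on $\Delta^+$, non-decreasing in each place, with identity $\varepsilon_0$; its continuity is with respect to $d_S$. A triangle function $\tau$ is sup-continuous if for every family $\{F_\lambda\}_{\lambda\in\Lambda}$ in $\Delta^+$ and every $G\in\Delta^+$, $\sup_\lambda\tau(F_\lambda,G)=\tau(\sup_\lambda F_\lambda,G)$ (pointwise suprema). A probabilistic normed (PN) space is a quadruple $(V,\nu,\tau,\tau^* )$ where $V$ is a linear space, $\tau,\tau^*$ are continuous triangle functions with $\tau\le\tau^*$, and $\nu:V\to\Delta^+$, $p\mapsto\nu_p$, satisfies: (N1) $\nu_p=\varepsilon_0$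 iff $p=\theta$ (the null vector); (N2) $\nu_{-p}=\nu_p$; (N3) $\nu_{p+q}\ge\tau(\nu_p,\nu_q)$; (N4) $\nu_p\le\tau^*(\nu_{\alpha p},\nu_{(1-\alpha)p})$ for every $\alpha\in[0,1]$; for all $p,q\in V$. The strong topology on $V$ is determined by the neighbourhoods $N_p(t)=\{q\in V:\nu_{q-p}(t)>1-t\}=\{q\in V: d_S(\nu_{q-p},\varepsilon_0)<t\}$, $t>0$. A sequence $(p_n)$ is strongly convergent to $p$ if for each $\lambda>0$ there is $N$ with $p_n\in N_p(\lambda)$ for $n\ge N$; it is strong Cauchy if for each $\lambda>0$ there is $N$ with $\nu_{p_n-p_m}(\lambda)>1-\lambda$ whenever $m,n>N$. A PN space is strongly complete if every strong Cauchy sequence in it is strongly convergent to a point of it; a PNB space is a strongly complete PN space. Quotient: for a linear subspace $W$, $V/\!\sim_W$ is the quotient by $p\sim_W q\Leftrightarrow p-q\in W$, and $\bar\nu_{p+W}(x)=\sup_{q\in W}\nu_{p+q}(x)$. *)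

theory Defs
  imports "HOL-Analysis.Analysis" "HOL-Algebra.Module" "HOL-Algebra.AbelCoset"
begin

text \<open>The set \<open>\<Delta>\<^sup>+\<close> is a type, so that its order, its metric and the
  continuity of operations on it are the type-class notions of the library.\<close>

typedef ddf = "{F :: ereal \<Rightarrow> real.
    (\<forall>x. 0 \<le> F x \<and> F x \<le> 1) \<and> mono F \<and>
    (\<forall>x :: real. continuous (at_left (ereal x)) F) \<and>
    F (-\<infinity>) = 0 \<and> F 0 = 0 \<and> F \<infinity> = 1}"
  morphisms dd Abs_ddf
proof -
  let ?F = "\<lambda>x :: ereal. if x = \<infinity> then 1 else 0 :: real"
  have "continuous (at_left (ereal x)) ?F" for x
  proof -
    have "eventually (\<lambda>y. ?F y = 0) (at_left (ereal x))"
      unfolding eventually_at_filter by (rule always_eventually) auto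
    then show ?thesis
      by (auto simp: continuous_within intro: tendsto_eventually)
  qed
  then show ?thesis
    by (intro exI[of _ ?F]) (auto simp: mono_def)
qed

lemma dd_nonneg: "0 \<le> dd F x"
  and dd_le_1: "dd F x \<le> 1"
  and dd_mono: "x \<le> y \<Longrightarrow> dd F x \<le> dd F y"
  and dd_left_continuous: "continuous (at_left (ereal r)) (dd F)"
  and dd_MInf: "dd F (-\<infinity>) = 0"
  and dd_zero: "dd F 0 = 0"
  and dd_PInf: "dd F \<infinity> = 1"
  using dd[of F] by (auto simp: mono_def)

instantiation ddf :: order
begin
definition "F \<le> G \<longleftrightarrow> (\<forall>x. dd F x \<le> dd G x)"
definition "F < G \<longleftrightarrow> F \<le> G \<and> \<not> G \<le> (F :: ddf)"
instance
  by standard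
    (auto simp: less_eq_ddf_def less_ddf_def dd_inject[symmetric] fun_eq_iff intro: order.trans antisym)
end

definition eps0 :: ddf where
  "eps0 = Abs_ddf (\<lambda>x. if x \<le> 0 then 0 else 1)"

lemma dd_eps0: "dd eps0 x = (if x \<le> 0 then 0 else 1)"
proof -
  let ?F = "\<lambda>x :: ereal. if x \<le> 0 then 0 else 1 :: real"
  have "continuous (at_left (ereal r)) ?F" for r
  proof (cases "r \<le> 0")
    case True
    have "eventually (\<lambda>y. ?F y = ?F (ereal r)) (at_left (ereal r))"
      unfolding eventually_at_filter using True
      by (intro always_eventually) (auto simp: zero_ereal_def intro: order.trans less_imp_le)
    then show ?thesis
      by (auto simp: continuous_within intro: tendsto_eventually)
  next
    case False
    have "eventually (\<lambda>y. y > 0) (at_left (ereal r))"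
      using False by (intro eventually_at_leftI[of 0]) (auto simp: zero_ereal_def)
    then have "eventually (\<lambda>y. ?F y = ?F (ereal r)) (at_left (ereal r))"
      by eventually_elim (use False in \<open>auto simp: zero_ereal_def\<close>)
    then show ?thesis
      by (auto simp: continuous_within intro: tendsto_eventually)
  qed
  then have "?F \<in> {F. (\<forall>x. 0 \<le> F x \<and> F x \<le> 1) \<and> mono F \<and>
      (\<forall>x :: real. continuous (at_left (ereal x)) F) \<and> F (-\<infinity>) = 0 \<and> F 0 = 0 \<and> F \<infinity> = 1}"
    by (auto simp: mono_def)
  then show ?thesis
    unfolding eps0_def by (subst Abs_ddf_inverse) auto
qed

text \<open>Suprema are pointwise. The pointwise supremum of the empty family is not in
  \<open>\<Delta>\<^sup>+\<close>; the value at the empty set is then the least element of \<open>\<Delta>\<^sup>+\<close>.\<close>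

instantiation ddf :: Sup
begin
definition "Sup S = Abs_ddf (\<lambda>x. if S = {} then (if x = \<infinity> then 1 else 0) else SUP F\<in>S. dd F x)"
instance ..
end

lemma bdd_above_dd: "bdd_above ((\<lambda>F. dd F x) ` S)"
  by (intro bdd_aboveI[of _ 1]) (auto simp: dd_le_1)

lemma dd_Sup:
  assumes "S \<noteq> {}"
  shows "dd (Sup S) x = (SUP F\<in>S. dd F x)"
proof -
  let ?F = "\<lambda>x. SUP F\<in>S. dd F x"
  obtain F0 where F0: "F0 \<in> S" using assms by auto
  have up: "dd F x \<le> ?F x" if "F \<in> S" for F x
    using that by (intro cSUP_upper bdd_above_dd)
  have rng: "0 \<le> ?F x \<and> ?F x \<le> 1" for x
    using up[OF F0, of x] dd_nonneg[of F0 x] assms by (auto intro!: cSUP_least dd_le_1)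
  have mono: "mono ?F"
  proof (rule monoI)
    fix x y :: ereal assume "x \<le> y"
    then show "?F x \<le> ?F y"
      using assms by (intro cSUP_least) (auto intro: order.trans[OF dd_mono up])
  qed
  have lc: "continuous (at_left (ereal r)) ?F" for r
    unfolding continuous_within
  proof (rule order_tendstoI)
    fix a assume "a < ?F (ereal r)"
    then obtain F where F: "F \<in> S" "a < dd F (ereal r)"
      using assms by (auto simp: less_cSUP_iff[OF assms bdd_above_dd])
    have "(dd F \<longlongrightarrow> dd F (ereal r)) (at_left (ereal r))"
      using dd_left_continuous by (simp add: continuous_within)
    from order_tendstoD(1)[OF this F(2)]
    show "eventually (\<lambda>x. a < ?F x) (at_left (ereal r))"
      by eventually_elim (use up[OF F(1)] in \<open>auto intro: less_le_trans\<close>)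
  next
    fix a assume a: "?F (ereal r) < a"
    show "eventually (\<lambda>x. ?F x < a) (at_left (ereal r))"
      unfolding eventually_at_filter
      by (intro always_eventually allI impI le_less_trans[OF monoD[OF mono] a]) auto
  qed
  have "?F \<in> {F. (\<forall>x. 0 \<le> F x \<and> F x \<le> 1) \<and> mono F \<and>
      (\<forall>x :: real. continuous (at_left (ereal x)) F) \<and> F (-\<infinity>) = 0 \<and> F 0 = 0 \<and> F \<infinity> = 1}"
    using rng mono lc assms by (auto simp: dd_MInf dd_zero dd_PInf)
  then show ?thesis
    using assms unfolding Sup_ddf_def by (simp add: Abs_ddf_inverse)
qed

definition sibley_cond :: "ddf \<Rightarrow> ddf \<Rightarrow> real \<Rightarrow> bool" where
  "sibley_cond F G h \<longleftrightarrow>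
     (\<forall>x\<in>{-1/h<..<1/h}. dd F (ereal (x - h)) - h \<le> dd G (ereal x) \<and>
                         dd G (ereal x) \<le> dd F (ereal (x + h)) + h)"

lemma sibley_cond_mono:
  assumes "sibley_cond F G h" "0 < h" "h \<le> k"
  shows "sibley_cond F G k"
  unfolding sibley_cond_def
proof
  fix x assume x: "x \<in> {-1/k<..<1/k}"
  have "1/k \<le> 1/h" using assms by (simp add: frac_le)
  then have "x \<in> {-1/h<..<1/h}" using x by auto
  then have *: "dd F (ereal (x - h)) - h \<le> dd G (ereal x) \<and>
      dd G (ereal x) \<le> dd F (ereal (x + h)) + h"
    using assms by (auto simp: sibley_cond_def)
  have "dd F (ereal (x - k)) \<le> dd F (ereal (x - h))" "dd F (ereal (x + h)) \<le> dd F (ereal (x + k))"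
    using assms by (auto intro: dd_mono)
  then show "dd F (ereal (x - k)) - k \<le> dd G (ereal x) \<and> dd G (ereal x) \<le> dd F (ereal (x + k)) + k"
    using * assms by linarith
qed

lemma sibley_cond_one: "sibley_cond F G 1"
  unfolding sibley_cond_def
proof
  fix x :: real
  show "dd F (ereal (x - 1)) - 1 \<le> dd G (ereal x) \<and> dd G (ereal x) \<le> dd F (ereal (x + 1)) + 1"
    using dd_le_1[of F "ereal (x - 1)"] dd_nonneg[of G "ereal x"]
      dd_le_1[of G "ereal x"] dd_nonneg[of F "ereal (x + 1)"] by linarith
qed

lemma sibley_cond_refl: "0 < h \<Longrightarrow> sibley_cond F F h"
proof -
  assume "0 < h"
  then have "dd F (ereal (x - h)) \<le> dd F (ereal x)" "dd F (ereal x) \<le> dd F (ereal (x + h))" for x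
    by (auto intro: dd_mono)
  then show ?thesis
    unfolding sibley_cond_def using \<open>0 < h\<close> by (auto intro: add_increasing2 simp: diff_le_eq)
qed

lemma sibley_cond_trans:
  assumes FG: "sibley_cond F G h" and GH: "sibley_cond G H k"
    and hk: "0 < h" "0 < k" "h + k \<le> 1"
  shows "sibley_cond F H (h + k)"
  unfolding sibley_cond_def
proof
  fix x assume x: "x \<in> {-1/(h+k)<..<1/(h+k)}"
  have a: "1/(h+k) \<le> 1/k" using hk by (simp add: frac_le)
  have "h * (h + k) \<le> 1" using hk by (intro mult_le_one) auto
  then have "k * (h * (h + k)) \<le> k" using hk by (simp add: mult_left_le)
  then have b: "1/(h+k) + k \<le> 1/h" using hk by (simp add: field_simps)
  have "x \<in> {-1/k<..<1/k}" using x a by auto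
  then have 1: "dd G (ereal (x - k)) - k \<le> dd H (ereal x)" "dd H (ereal x) \<le> dd G (ereal (x + k)) + k"
    using GH by (auto simp: sibley_cond_def)
  have "x - k \<in> {-1/h<..<1/h}" "x + k \<in> {-1/h<..<1/h}" using x b hk by auto
  then have 2: "dd F (ereal (x - k - h)) - h \<le> dd G (ereal (x - k))"
      "dd G (ereal (x + k)) \<le> dd F (ereal (x + k + h)) + h"
    using FG by (auto simp: sibley_cond_def)
  have e: "x - k - h = x - (h + k)" "x + k + h = x + (h + k)" by auto
  then show "dd F (ereal (x - (h + k))) - (h + k) \<le> dd H (ereal x) \<and>
      dd H (ereal x) \<le> dd F (ereal (x + (h + k))) + (h + k)"
    using 1 2 unfolding e by linarith
qed

lemma le_ddf_of_sibley_cond: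
  assumes "\<And>h. 0 < h \<Longrightarrow> sibley_cond F G h"
  shows "F \<le> G"
  unfolding less_eq_ddf_def
proof
  fix x :: ereal
  show "dd F x \<le> dd G x"
  proof (cases x)
    case (real r)
    have lim: "((\<lambda>h. dd F (ereal (r - h)) - h) \<longlongrightarrow> dd F (ereal r) - 0) (at_right 0)"
    proof (intro tendsto_diff tendsto_ident_at)
      have "(dd F \<longlongrightarrow> dd F (ereal r)) (at_left (ereal r))"
        using dd_left_continuous by (simp add: continuous_within)
      moreover have "filterlim (\<lambda>h. ereal (r - h)) (at_left (ereal r)) (at_right 0)"
        unfolding filterlim_at
        by (auto simp: eventually_at_filter intro!: always_eventually tendsto_eq_intros)
      ultimately show "((\<lambda>h. dd F (ereal (r - h))) \<longlongrightarrow> dd F (ereal r)) (at_right 0)"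
        by (rule filterlim_compose)
    qed
    have ev: "eventually (\<lambda>h. dd F (ereal (r - h)) - h \<le> dd G (ereal r)) (at_right 0)"
    proof (rule eventually_at_rightI[of 0 "1 / (\<bar>r\<bar> + 1)"])
      fix h assume "h \<in> {0<..<1 / (\<bar>r\<bar> + 1)}"
      then have h: "0 < h" "h < 1 / (\<bar>r\<bar> + 1)" by auto
      then have "\<bar>r\<bar> < 1 / h" by (simp add: field_simps)
      then have "r \<in> {-1/h<..<1/h}" by auto
      then show "dd F (ereal (r - h)) - h \<le> dd G (ereal r)"
        using assms[OF h(1)] unfolding sibley_cond_def by blast
    qed simp
    have "dd F (ereal r) - 0 \<le> dd G (ereal r)"
      by (rule tendsto_upperbound[OF lim ev]) simp
    then show ?thesis using real by simp
  qed (simp_all add: dd_MInf dd_PInf)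
qed

instantiation ddf :: metric_space
begin

definition dist_ddf :: "ddf \<Rightarrow> ddf \<Rightarrow> real" where
  "dist F G = Inf {h. 0 < h \<and> h \<le> 1 \<and> sibley_cond F G h \<and> sibley_cond G F h}"

definition uniformity_ddf :: "(ddf \<times> ddf) filter" where
  "uniformity_ddf = (INF e\<in>{0 <..}. principal {(x, y). dist x y < e})"

definition open_ddf :: "ddf set \<Rightarrow> bool" where
  "open_ddf U \<longleftrightarrow> (\<forall>x\<in>U. eventually (\<lambda>(x', y). x' = x \<longrightarrow> y \<in> U) uniformity)"

lemma dist_ddf_bdd: "bdd_below {h::real. 0 < h \<and> h \<le> 1 \<and> P h}"
  by (intro bdd_belowI[of _ 0]) auto

lemma dist_ddf_nonempty: "1 \<in> {h. 0 < h \<and> h \<le> 1 \<and> sibley_cond F G h \<and> sibley_cond G F h}"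
  by (simp add: sibley_cond_one)

lemma dist_ddf_less_imp:
  assumes "dist F (G :: ddf) < h"
  shows "sibley_cond F G h \<and> sibley_cond G F h"
proof -
  obtain k where "k < h" "0 < k" "sibley_cond F G k" "sibley_cond G F k"
    using assms dist_ddf_nonempty[of F G] unfolding dist_ddf_def
    by (subst (asm) cInf_less_iff) (auto simp: dist_ddf_bdd)
  then show ?thesis by (auto intro: sibley_cond_mono)
qed

lemma dist_ddf_le:
  assumes "0 < h" "h \<le> 1" "sibley_cond F G h" "sibley_cond G F h"
  shows "dist F (G :: ddf) \<le> h"
  unfolding dist_ddf_def using assms by (intro cInf_lower dist_ddf_bdd) auto

lemma dist_ddf_ge_0: "0 \<le> dist F (G :: ddf)"
  unfolding dist_ddf_def using dist_ddf_nonempty[of F G] by (intro cInf_greatest) auto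

instance
proof
  fix F G H :: ddf
  show "(dist F G = 0) = (F = G)"
  proof
    assume "dist F G = 0"
    then have "\<And>h. 0 < h \<Longrightarrow> sibley_cond F G h" "\<And>h. 0 < h \<Longrightarrow> sibley_cond G F h"
      using dist_ddf_less_imp[of F G] by auto
    then show "F = G" by (intro antisym le_ddf_of_sibley_cond)
  next
    assume "F = G"
    have "dist F F \<le> 0 + e" if "0 < e" for e
      using dist_ddf_le[of "min e 1" F F] that by (auto simp: sibley_cond_refl)
    then have "dist F F \<le> 0" by (rule field_le_epsilon)
    then show "dist F G = 0" using dist_ddf_ge_0[of F G] \<open>F = G\<close> by auto
  qed
  have sym: "dist F G = dist G F" for F G :: ddf
    unfolding dist_ddf_def by (rule arg_cong[of _ _ Inf]) auto
  show "dist F G \<le> dist F H + dist G H"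
  proof (rule field_le_epsilon)
    fix e :: real assume e: "0 < e"
    define h k where "h = dist F H + e/2" and "k = dist G H + e/2"
    have hk: "0 < h" "0 < k" "dist F H < h" "dist H G < k"
      using e dist_ddf_ge_0[of F H] dist_ddf_ge_0[of G H] by (auto simp: h_def k_def sym[of H G])
    have "dist F G \<le> h + k"
    proof (cases "h + k \<le> 1")
      case True
      have "sibley_cond F G (h + k)" "sibley_cond G F (k + h)"
        using dist_ddf_less_imp[OF hk(3)] dist_ddf_less_imp[OF hk(4)] hk True
        by (auto intro: sibley_cond_trans)
      then show ?thesis using hk True by (intro dist_ddf_le) (auto simp: add.commute)
    next
      case False
      have "dist F G \<le> 1" by (rule dist_ddf_le) (auto simp: sibley_cond_one)
      then show ?thesis using False by simp
    qed
    then show "dist F G \<le> dist F H + dist G H + e" by (simp add: h_def k_def)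
  qed
qed (simp_all add: uniformity_ddf_def open_ddf_def)

end

lemma dd_eps0_ereal: "dd eps0 (ereal x) = (if x \<le> 0 then 0 else 1)"
  by (simp add: dd_eps0)

lemma dist_eps0_less_iff:
  fixes t :: real
  assumes "0 < t"
  shows "dist F eps0 < t \<longleftrightarrow> dd F (ereal t) > 1 - t"
proof (cases "1 < t")
  case True
  have "dist F eps0 \<le> 1" by (rule dist_ddf_le) (auto simp: sibley_cond_one)
  with True show ?thesis using dd_nonneg[of F "ereal t"] by simp
next
  case False
  show ?thesis
  proof
    assume d: "dist F eps0 < t"
    define s where "s = (dist F eps0 + t) / 2"
    have mid: "r < (r + t) / 2 \<and> (r + t) / 2 < t \<and> 0 < (r + t) / 2 \<and> (r + t) / 2 < 1"
      if "0 \<le> r" "r < t" for r :: real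
      using that False assms by (simp add: field_simps)
    have s: "dist F eps0 < s" "s < t" "0 < s" "s < 1"
      unfolding s_def using mid[OF zero_le_dist d] by simp_all
    have "1 < 1 / s" using s by simp
    then have "s < 1 / s" using s by linarith
    then obtain x where x: "s < x" "x < min t (1 / s)"
      using s dense[of s "min t (1 / s)"] by auto
    have "sibley_cond eps0 F s" using dist_ddf_less_imp[OF s(1)] by simp
    moreover have "-1/s < 0" using s by simp
    then have "x \<in> {-1/s<..<1/s}" using x s by auto
    ultimately have "dd eps0 (ereal (x - s)) - s \<le> dd F (ereal x)"
      unfolding sibley_cond_def by blast
    then have "1 - s \<le> dd F (ereal x)" using x by (simp add: dd_eps0_ereal)
    also have "\<dots> \<le> dd F (ereal t)" using x by (intro dd_mono) auto
    finally show "dd F (ereal t) > 1 - t" using s by simp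
  next
    assume t: "dd F (ereal t) > 1 - t"
    have "((\<lambda>s. dd F (ereal s) + s) \<longlongrightarrow> dd F (ereal t) + t) (at_left t)"
    proof (intro tendsto_add tendsto_ident_at)
      have "(dd F \<longlongrightarrow> dd F (ereal t)) (at_left (ereal t))"
        using dd_left_continuous by (simp add: continuous_within)
      moreover have "filterlim ereal (at_left (ereal t)) (at_left t)"
        unfolding filterlim_at
        by (auto simp: eventually_at_filter intro!: always_eventually tendsto_eq_intros)
      ultimately show "((\<lambda>s. dd F (ereal s)) \<longlongrightarrow> dd F (ereal t)) (at_left t)"
        by (rule filterlim_compose)
    qed
    then have "eventually (\<lambda>s. 1 < dd F (ereal s) + s) (at_left t)"
      by (rule order_tendstoD) (use t in simp)
    moreover have "eventually (\<lambda>s. s \<in> {0<..<t}) (at_left t)"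
      using assms by (rule eventually_at_left_real)
    ultimately have "eventually (\<lambda>s. 1 < dd F (ereal s) + s \<and> s \<in> {0<..<t}) (at_left t)"
      by (rule eventually_conj)
    then obtain s where s: "1 < dd F (ereal s) + s" "0 < s" "s < t"
      using eventually_happens[of _ "at_left t"] by (auto simp: trivial_limit_at_left_real)
    have neg: "dd F (ereal x) = 0" if "x \<le> 0" for x
      using that dd_mono[of "ereal x" 0 F] dd_nonneg[of F "ereal x"] by (simp add: dd_zero flip: zero_ereal_def)
    have "sibley_cond F eps0 s"
      unfolding sibley_cond_def
    proof (intro ballI conjI)
      fix x :: real
      show "dd F (ereal (x - s)) - s \<le> dd eps0 (ereal x)"
        using s neg[of "x - s"] dd_le_1[of F "ereal (x - s)"] by (auto simp: dd_eps0_ereal)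
      show "dd eps0 (ereal x) \<le> dd F (ereal (x + s)) + s"
        using s dd_mono[of "ereal s" "ereal (x + s)" F] dd_nonneg[of F "ereal (x + s)"]
        by (auto simp: dd_eps0_ereal)
    qed
    moreover have "sibley_cond eps0 F s"
      unfolding sibley_cond_def
    proof (intro ballI conjI)
      fix x :: real
      show "dd eps0 (ereal (x - s)) - s \<le> dd F (ereal x)"
        using s dd_mono[of "ereal s" "ereal x" F] dd_nonneg[of F "ereal x"]
        by (auto simp: dd_eps0_ereal)
      show "dd F (ereal x) \<le> dd eps0 (ereal (x + s)) + s"
        using s neg[of x] dd_le_1[of F "ereal x"] by (auto simp: dd_eps0_ereal)
    qed
    ultimately have "dist F eps0 \<le> s" using s False by (intro dist_ddf_le) auto
    then show "dist F eps0 < t" using s by simp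
  qed
qed

definition triangle_function :: "(ddf \<Rightarrow> ddf \<Rightarrow> ddf) \<Rightarrow> bool" where
  "triangle_function \<tau> \<longleftrightarrow>
     (\<forall>F G H. \<tau> (\<tau> F G) H = \<tau> F (\<tau> G H)) \<and>
     (\<forall>F G. \<tau> F G = \<tau> G F) \<and>
     (\<forall>F G H. F \<le> G \<longrightarrow> \<tau> F H \<le> \<tau> G H) \<and>
     (\<forall>F G H. F \<le> G \<longrightarrow> \<tau> H F \<le> \<tau> H G) \<and>
     (\<forall>F. \<tau> F eps0 = F)"

definition continuous_triangle_function :: "(ddf \<Rightarrow> ddf \<Rightarrow> ddf) \<Rightarrow> bool" where
  "continuous_triangle_function \<tau> \<longleftrightarrow>
     triangle_function \<tau> \<and> continuous_on UNIV (\<lambda>(F, G). \<tau> F G)"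

text \<open>Both sides depend only on the set of members of the family, so families are given by
  (nonempty) sets.\<close>

definition sup_continuous_tf :: "(ddf \<Rightarrow> ddf \<Rightarrow> ddf) \<Rightarrow> bool" where
  "sup_continuous_tf \<tau> \<longleftrightarrow> (\<forall>S G. S \<noteq> {} \<longrightarrow> (SUP F\<in>S. \<tau> F G) = \<tau> (Sup S) G)"

text \<open>Linear spaces are modules over the field of real numbers.\<close>

definition real_field :: "real ring" where
  "real_field = \<lparr>carrier = UNIV, monoid.mult = (*), one = 1, ring.zero = 0, add = (+)\<rparr>"

lemma field_real_field: "Ring.field real_field"
proof -
  have "cring real_field"
  proof (intro cringI abelian_groupI comm_monoidI)
    fix x :: real
    show "\<exists>y\<in>carrier real_field. y \<oplus>\<^bsub>real_field\<^esub> x = \<zero>\<^bsub>real_field\<^esub>"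
      by (rule bexI[of _ "- x"]) (auto simp: real_field_def)
  qed (auto simp: real_field_def algebra_simps)
  then show ?thesis
    by (rule cring.cring_fieldI2)
      (auto simp: real_field_def intro: exI[of _ "1 / _"] right_inverse)
qed

locale pn_space = Module.module real_field V
  for V (structure) +
  fixes \<nu> :: "'v \<Rightarrow> ddf" and \<tau> \<tau>s :: "ddf \<Rightarrow> ddf \<Rightarrow> ddf"
  assumes tau: "continuous_triangle_function \<tau>"
    and taus: "continuous_triangle_function \<tau>s"
    and tau_le_taus: "\<tau> F G \<le> \<tau>s F G"
    and N1: "p \<in> carrier V \<Longrightarrow> \<nu> p = eps0 \<longleftrightarrow> p = \<zero>"
    and N2: "p \<in> carrier V \<Longrightarrow> \<nu> (\<ominus> p) = \<nu> p"
    and N3: "p \<in> carrier V \<Longrightarrow> q \<in> carrier V \<Longrightarrow> \<tau> (\<nu> p) (\<nu> q) \<le> \<nu> (p \<oplus> q)"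
    and N4: "p \<in> carrier V \<Longrightarrow> 0 \<le> \<alpha> \<Longrightarrow> \<alpha> \<le> 1 \<Longrightarrow>
      \<nu> p \<le> \<tau>s (\<nu> (\<alpha> \<odot> p)) (\<nu> ((1 - \<alpha>) \<odot> p))"

definition strong_nbhd ::
    "(real, 'v, 'm) module_scheme \<Rightarrow> ('v \<Rightarrow> ddf) \<Rightarrow> 'v \<Rightarrow> real \<Rightarrow> 'v set" where
  "strong_nbhd V \<nu> p t = {q \<in> carrier V. dd (\<nu> (q \<ominus>\<^bsub>V\<^esub> p)) (ereal t) > 1 - t}"

definition strong_topology ::
    "(real, 'v, 'm) module_scheme \<Rightarrow> ('v \<Rightarrow> ddf) \<Rightarrow> 'v topology" where
  "strong_topology V \<nu> =
     topology (\<lambda>U. U \<subseteq> carrier V \<and> (\<forall>p\<in>U. \<exists>t>0. strong_nbhd V \<nu> p t \<subseteq> U))"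

lemma strong_nbhd_mono: "s \<le> t \<Longrightarrow> strong_nbhd V \<nu> p s \<subseteq> strong_nbhd V \<nu> p t"
proof
  fix q assume "s \<le> t" and q: "q \<in> strong_nbhd V \<nu> p s"
  then have "dd (\<nu> (q \<ominus>\<^bsub>V\<^esub> p)) (ereal s) \<le> dd (\<nu> (q \<ominus>\<^bsub>V\<^esub> p)) (ereal t)"
    by (auto intro: dd_mono)
  with \<open>s \<le> t\<close> q show "q \<in> strong_nbhd V \<nu> p t"
    by (auto simp: strong_nbhd_def)
qed

lemma openin_strong_topology:
  "openin (strong_topology V \<nu>) U \<longleftrightarrow>
     U \<subseteq> carrier V \<and> (\<forall>p\<in>U. \<exists>t>0. strong_nbhd V \<nu> p t \<subseteq> U)"
proof -
  have "istopology (\<lambda>U. U \<subseteq> carrier V \<and> (\<forall>p\<in>U. \<exists>t>0. strong_nbhd V \<nu> p t \<subseteq> U))"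
    unfolding istopology_def
  proof (intro conjI allI impI ballI)
    fix S T p
    assume S: "S \<subseteq> carrier V \<and> (\<forall>p\<in>S. \<exists>t>0. strong_nbhd V \<nu> p t \<subseteq> S)"
      and T: "T \<subseteq> carrier V \<and> (\<forall>p\<in>T. \<exists>t>0. strong_nbhd V \<nu> p t \<subseteq> T)" and p: "p \<in> S \<inter> T"
    obtain s t where "s > 0" "strong_nbhd V \<nu> p s \<subseteq> S" "t > 0" "strong_nbhd V \<nu> p t \<subseteq> T"
      using S T p by blast
    then show "\<exists>t>0. strong_nbhd V \<nu> p t \<subseteq> S \<inter> T"
      using strong_nbhd_mono[of "min s t" s V \<nu> p] strong_nbhd_mono[of "min s t" t V \<nu> p]
      by (intro exI[of _ "min s t"]) auto
  next
    fix K p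
    assume K: "\<forall>S\<in>K. S \<subseteq> carrier V \<and> (\<forall>p\<in>S. \<exists>t>0. strong_nbhd V \<nu> p t \<subseteq> S)" and "p \<in> \<Union>K"
    then obtain S where "S \<in> K" "p \<in> S" by blast
    with K show "\<exists>t>0. strong_nbhd V \<nu> p t \<subseteq> \<Union>K" by (meson Union_upper order.trans)
  qed auto
  then show ?thesis
    unfolding strong_topology_def by (simp add: topology_inverse')
qed

definition strongly_convergent_to ::
    "(real, 'v, 'm) module_scheme \<Rightarrow> ('v \<Rightarrow> ddf) \<Rightarrow> (nat \<Rightarrow> 'v) \<Rightarrow> 'v \<Rightarrow> bool" where
  "strongly_convergent_to V \<nu> s p \<longleftrightarrow> (\<forall>l>0. \<exists>N. \<forall>n\<ge>N. s n \<in> strong_nbhd V \<nu> p l)"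

definition strong_Cauchy ::
    "(real, 'v, 'm) module_scheme \<Rightarrow> ('v \<Rightarrow> ddf) \<Rightarrow> (nat \<Rightarrow> 'v) \<Rightarrow> bool" where
  "strong_Cauchy V \<nu> s \<longleftrightarrow>
     (\<forall>l>0. \<exists>N. \<forall>m n. m > N \<and> n > N \<longrightarrow> dd (\<nu> (s n \<ominus>\<^bsub>V\<^esub> s m)) (ereal l) > 1 - l)"

locale pnb_space = pn_space +
  assumes strongly_complete:
    "range s \<subseteq> carrier V \<Longrightarrow> strong_Cauchy V \<nu> s \<Longrightarrow>
       \<exists>p\<in>carrier V. strongly_convergent_to V \<nu> s p"

text \<open>The quotient linear space, with cosets as elements. The scalar multiple of the coset
  \<open>p + W\<close> by \<open>a\<close> is \<open>a p + W\<close>; the plain image of \<open>p + W\<close> under multiplication by \<open>a\<close> would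
  be wrong for \<open>a = 0\<close>. The fields \<open>mult\<close> and \<open>one\<close> of the record play no role in modules.\<close>

definition quotient_space ::
    "(real, 'v, 'm) module_scheme \<Rightarrow> 'v set \<Rightarrow> (real, 'v set) module" where
  "quotient_space V W =
     \<lparr>carrier = a_rcosets\<^bsub>V\<^esub> W, monoid.mult = undefined, one = undefined,
      ring.zero = W, add = set_add V,
      smult = (\<lambda>a P. \<Union>p\<in>P. W +>\<^bsub>V\<^esub> (a \<odot>\<^bsub>V\<^esub> p))\<rparr>"

lemma (in pn_space) smult_quotient_space:
  assumes "submodule W real_field V" "p \<in> carrier V"
  shows "a \<odot>\<^bsub>quotient_space V W\<^esub> (W +> p) = W +> (a \<odot> p)"
proof -
  interpret W: abelian_subgroup W V
    using assms(1) M.abelian_group_axioms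
    by (intro abelian_subgroupI3) (auto simp: additive_subgroup_def submodule_def)
  have a: "a \<in> carrier real_field" by (simp add: real_field_def)
  have "W +> (a \<odot> p') = W +> (a \<odot> p)" if "p' \<in> W +> p" for p'
  proof -
    obtain w where w: "w \<in> W" "p' = w \<oplus> p" using \<open>p' \<in> W +> p\<close> by (auto simp: a_r_coset_def')
    have wV: "w \<in> carrier V" using w W.a_subset by auto
    have "a \<odot> w \<in> W" using submoduleE(4)[OF assms(1) a w(1)] .
    moreover have "a \<odot> p' = a \<odot> w \<oplus> a \<odot> p" using w wV a assms by (simp add: smult_r_distr)
    ultimately have "a \<odot> p' \<in> W +> (a \<odot> p)" by (auto simp: a_r_coset_def')
    then show ?thesis using a assms(2) by (metis W.a_repr_independence' smult_closed)
  qed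
  moreover have "p \<in> W +> p" using assms(2) by (rule W.a_rcos_self)
  ultimately have "(\<Union>p'\<in>W +> p. W +> (a \<odot> p')) = W +> (a \<odot> p)"
    by (intro UN_constant_eq ballI)
  then show ?thesis by (simp add: quotient_space_def)
qed

text \<open>Since \<open>p + W\<close> is the set of all \<open>p + q\<close> with \<open>q \<in> W\<close>, the supremum runs over the elements of
  the coset; the representative does not enter.\<close>

definition quotient_norm :: "('v \<Rightarrow> ddf) \<Rightarrow> 'v set \<Rightarrow> ddf" where
  "quotient_norm \<nu> P = (SUP p\<in>P. \<nu> p)"

lemma (in pn_space) dd_quotient_norm:
  assumes "submodule W real_field V" "p \<in> carrier V"
  shows "dd (quotient_norm \<nu> (W +> p)) x = (SUP q\<in>W. dd (\<nu> (p \<oplus> q)) x)"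
proof -
  have W: "W \<subseteq> carrier V" "W \<noteq> {}"
    using submoduleE[OF assms(1)] by auto
  have "W +> p = (\<lambda>q. p \<oplus> q) ` W"
    using W assms(2) by (auto simp: a_r_coset_def' a_comm subset_iff image_iff)
  then show ?thesis
    using W by (simp add: quotient_norm_def dd_Sup image_image)
qed

end

theory Submission
  imports Defs
begin

text \<open>The axioms of the quotient norm follow from those of \<open>\<nu>\<close> by taking suprema over cosets:
  sup-continuity moves the suprema out of \<open>\<tau>\<close>, and closedness of \<open>W\<close> gives the definiteness
  in N1. For completeness, continuity of \<open>\<tau>\<close> at \<open>(eps0, eps0)\<close> yields radii \<open>\<delta> n\<close>, tending to
  \<open>0\<close>, such that two consecutive steps of size \<open>\<delta> (Suc n)\<close> combine to one of size \<open>\<delta> n\<close>. From a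
  Cauchy sequence of cosets one extracts a subsequence with steps of size \<open>\<delta> (Suc n)\<close> and lifts
  it, step by step, to representatives. The lift is Cauchy in \<open>V\<close>, and the coset of its limit is
  the limit of the given sequence.\<close>

section \<open>Order, suprema and the distance to \<open>eps0\<close> for distribution
  functions\<close>

lemma le_Sup_ddf:
  fixes F :: ddf
  assumes "F \<in> S"
  shows "F \<le> Sup S"
proof -
  have "S \<noteq> {}" using assms by auto
  then show ?thesis
    using assms by (auto simp: less_eq_ddf_def dd_Sup intro!: cSUP_upper bdd_above_dd)
qed

lemma Sup_ddf_least:
  fixes G :: ddf
  assumes "S \<noteq> {}" "\<And>F. F \<in> S \<Longrightarrow> F \<le> G"
  shows "Sup S \<le> G"
  using assms by (auto simp: less_eq_ddf_def dd_Sup intro!: cSUP_least)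

lemma le_eps0: "F \<le> eps0"
  unfolding less_eq_ddf_def
proof
  fix x
  show "dd F x \<le> dd eps0 x"
    using dd_mono[of x 0 F] dd_le_1[of F x] by (auto simp: dd_eps0 dd_zero)
qed

text \<open>Uses \<open>dist_eps0_less_iff\<close> at the radius \<open>dist G eps0\<close> itself:
  if \<open>F\<close> were strictly nearer, it would pass the threshold there, hence so would the
  larger \<open>G\<close>, which would then be nearer than its own distance.\<close>

lemma dist_eps0_antimono:
  assumes "F \<le> G"
  shows "dist G eps0 \<le> dist F eps0"
proof (rule ccontr)
  assume "\<not> ?thesis"
  then have less: "dist F eps0 < dist G eps0" by simp
  then have pos: "0 < dist G eps0" using zero_le_dist[of F eps0] by linarith
  have "dd F (ereal (dist G eps0)) > 1 - dist G eps0"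
    using less dist_eps0_less_iff[OF pos] by blast
  then have "dd G (ereal (dist G eps0)) > 1 - dist G eps0"
    using assms by (auto simp: less_eq_ddf_def intro: less_le_trans)
  then show False using dist_eps0_less_iff[OF pos, of G] by simp
qed

text \<open>Being within \<open>t\<close> of \<open>eps0\<close> concerns the value at the single
  point \<open>t\<close>, and suprema are pointwise; a supremum of reals above \<open>1 - t\<close>
  has a member above \<open>1 - t\<close>.\<close>

lemma dist_Sup_eps0_lessD:
  assumes "S \<noteq> {}" "dist (Sup S) eps0 < t"
  shows "\<exists>F\<in>S. dist F eps0 < t"
proof -
  have t: "0 < t" using assms(2) zero_le_dist[of "Sup S" eps0] by linarith
  then have "1 - t < (SUP F\<in>S. dd F (ereal t))"
    using assms by (simp add: dist_eps0_less_iff dd_Sup)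
  then show ?thesis
    using assms(1) t by (auto simp: less_cSUP_iff[OF _ bdd_above_dd] dist_eps0_less_iff)
qed

text \<open>The two suprema are moved out one after the other: sup-continuity acts on the first
  place, and commutativity brings the second argument there.\<close>

lemma sup_continuous_tf_le:
  assumes "triangle_function \<tau>" "sup_continuous_tf \<tau>" "S \<noteq> {}" "T \<noteq> {}"
    and le: "\<And>F G. F \<in> S \<Longrightarrow> G \<in> T \<Longrightarrow> \<tau> F G \<le> H"
  shows "\<tau> (Sup S) (Sup T) \<le> H"
proof -
  have comm: "\<tau> F G = \<tau> G F" for F G
    using assms(1) unfolding triangle_function_def by blast
  have sup: "\<tau> (Sup S) G = (SUP F\<in>S. \<tau> F G)" if "S \<noteq> {}" for S G
    using assms(2) that by (simp add: sup_continuous_tf_def)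
  have "\<tau> F (Sup T) \<le> H" if "F \<in> S" for F
    unfolding comm[of F] sup[OF assms(4)]
    using assms(4) le[OF that] by (intro Sup_ddf_least) (auto simp: comm[of _ F])
  then show ?thesis
    unfolding sup[OF assms(3)] using assms(3) by (intro Sup_ddf_least) auto
qed

text \<open>Continuity at \<open>(eps0, eps0)\<close>, where the value is \<open>eps0\<close>
  because \<open>eps0\<close> is the identity. Radius \<open>e/2\<close> in each place keeps the
  pair within \<open>e\<close> in the product metric.\<close>

lemma continuous_triangle_function_at_eps0:
  assumes "continuous_triangle_function \<tau>" "0 < t"
  shows "\<exists>d>0. \<forall>F G. dist F eps0 < d \<longrightarrow> dist G eps0 < d \<longrightarrow> dist (\<tau> F G) eps0 < t"
proof -
  have id: "\<tau> eps0 eps0 = eps0"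
    using assms(1) by (simp add: continuous_triangle_function_def triangle_function_def)
  have "continuous_on UNIV (\<lambda>(F, G). \<tau> F G)"
    using assms(1) by (simp add: continuous_triangle_function_def)
  then obtain e where e: "e > 0"
    "\<And>x. dist x (eps0, eps0) < e \<Longrightarrow> dist (case x of (F, G) \<Rightarrow> \<tau> F G) eps0 < t"
    using assms(2) unfolding continuous_on_iff by (metis UNIV_I case_prod_conv id)
  have "dist (\<tau> F G) eps0 < t" if "dist F eps0 < e/2" "dist G eps0 < e/2" for F G
    using e(2)[of "(F, G)"] that by (simp add: dist_Pair_Pair sqrt_sum_squares_half_less)
  then show ?thesis using e(1) by (intro exI[of _ "e/2"]) auto
qed

section \<open>The strong topology and Cauchy sequences through the distance to
  \<open>eps0\<close>\<close>

lemma mem_strong_nbhd_iff: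
  "0 < t \<Longrightarrow> q \<in> strong_nbhd V \<nu> p t \<longleftrightarrow> q \<in> carrier V \<and> dist (\<nu> (q \<ominus>\<^bsub>V\<^esub> p)) eps0 < t"
  by (simp add: strong_nbhd_def dist_eps0_less_iff)

lemma strong_Cauchy_iff_dist:
  "strong_Cauchy V \<nu> s \<longleftrightarrow>
     (\<forall>l>0. \<exists>N. \<forall>m n. m > N \<and> n > N \<longrightarrow> dist (\<nu> (s n \<ominus>\<^bsub>V\<^esub> s m)) eps0 < l)"
  unfolding strong_Cauchy_def by (simp add: dist_eps0_less_iff)

lemma topspace_strong_topology: "topspace (strong_topology V \<nu>) = carrier V"
proof -
  have "openin (strong_topology V \<nu>) (carrier V)"
    by (auto simp: openin_strong_topology strong_nbhd_def intro!: exI[of _ 1])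
  then show ?thesis
    by (intro antisym openin_subset) (auto simp: topspace_def openin_strong_topology)
qed

context pn_space
begin

lemma norm_minus_commute:
  assumes "p \<in> carrier V" "q \<in> carrier V"
  shows "\<nu> (p \<ominus> q) = \<nu> (q \<ominus> p)"
proof -
  have "p \<ominus> q = \<ominus> (q \<ominus> p)"
    using assms by (simp add: a_minus_def M.minus_add M.a_comm)
  then show ?thesis using assms by (simp add: N2)
qed

text \<open>Substitute for the triangle inequality, uniform in the points: by N3 the norm of the sum
  dominates the \<open>\<tau>\<close>-combination of the two norms, and larger functions are nearer
  to \<open>eps0\<close>.\<close>

lemma dist_norm_triangle:
  assumes "0 < t"
  shows "\<exists>d>0. \<forall>p\<in>carrier V. \<forall>q\<in>carrier V. \<forall>r\<in>carrier V.
     dist (\<nu> (p \<ominus> q)) eps0 < d \<longrightarrow> dist (\<nu> (q \<ominus> r)) eps0 < d \<longrightarrow> dist (\<nu> (p \<ominus> r)) eps0 < t"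
proof -
  obtain d where d: "d > 0"
    "\<And>F G. dist F eps0 < d \<Longrightarrow> dist G eps0 < d \<Longrightarrow> dist (\<tau> F G) eps0 < t"
    using continuous_triangle_function_at_eps0[OF tau assms] by blast
  have "dist (\<nu> (p \<ominus> r)) eps0 < t"
    if V: "p \<in> carrier V" "q \<in> carrier V" "r \<in> carrier V"
      and near: "dist (\<nu> (p \<ominus> q)) eps0 < d" "dist (\<nu> (q \<ominus> r)) eps0 < d" for p q r
  proof -
    have "(p \<ominus> q) \<oplus> (q \<ominus> r) = p \<ominus> r"
      using V by (simp add: a_minus_def M.a_assoc M.r_neg1)
    then have "\<tau> (\<nu> (p \<ominus> q)) (\<nu> (q \<ominus> r)) \<le> \<nu> (p \<ominus> r)"
      using N3[of "p \<ominus> q" "q \<ominus> r"] V by simp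
    then show ?thesis
      using dist_eps0_antimono d(2)[OF near] by (blast intro: le_less_trans)
  qed
  then show ?thesis using d(1) by blast
qed

lemma strong_Cauchy_subsequence_convergent:
  assumes "range s \<subseteq> carrier V" "strong_Cauchy V \<nu> s" "p \<in> carrier V" "strict_mono k"
    and "strongly_convergent_to V \<nu> (s \<circ> k) p"
  shows "strongly_convergent_to V \<nu> s p"
  unfolding strongly_convergent_to_def
proof (intro allI impI)
  fix l :: real assume l: "l > 0"
  obtain d where d: "d > 0" and tri: "\<And>p q r. \<lbrakk>p \<in> carrier V; q \<in> carrier V; r \<in> carrier V;
      dist (\<nu> (p \<ominus> q)) eps0 < d; dist (\<nu> (q \<ominus> r)) eps0 < d\<rbrakk> \<Longrightarrow> dist (\<nu> (p \<ominus> r)) eps0 < l"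
    using dist_norm_triangle[OF l] by blast
  obtain N where N: "\<And>m n. m > N \<Longrightarrow> n > N \<Longrightarrow> dist (\<nu> (s n \<ominus> s m)) eps0 < d"
    using assms(2) d unfolding strong_Cauchy_iff_dist by blast
  obtain M where M: "\<And>n. n \<ge> M \<Longrightarrow> s (k n) \<in> strong_nbhd V \<nu> p d"
    using assms(5) d unfolding strongly_convergent_to_def by auto
  \<comment> \<open>One term of the subsequence beyond both thresholds: it is near \<open>p\<close>,
    and since \<open>k i \<ge> i\<close> its index exceeds \<open>N\<close>, so all later terms of
    \<open>s\<close> are near it.\<close>
  define j where "j = k (max M (Suc N))"
  have "j > N" using strict_mono_imp_increasing[OF assms(4), of "max M (Suc N)"] by (simp add: j_def)
  have j: "dist (\<nu> (s j \<ominus> p)) eps0 < d"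
    using M[of "max M (Suc N)"] d by (simp add: j_def mem_strong_nbhd_iff)
  have V: "s n \<in> carrier V" for n using assms(1) by auto
  show "\<exists>N. \<forall>n\<ge>N. s n \<in> strong_nbhd V \<nu> p l"
  proof (intro exI[of _ "Suc N"] allI impI)
    fix n assume "n \<ge> Suc N"
    then have "dist (\<nu> (s n \<ominus> s j)) eps0 < d" using N[OF \<open>j > N\<close>] by simp
    from tri[OF V V assms(3) this j] show "s n \<in> strong_nbhd V \<nu> p l"
      using V l by (simp add: mem_strong_nbhd_iff)
  qed
qed

text \<open>Iterates \<open>dist_norm_triangle\<close>, choosing each radius from the one before;
  the geometric bound makes the radii tend to \<open>0\<close>.\<close>

lemma halving_radii:
  "\<exists>\<delta> :: nat \<Rightarrow> real. (\<forall>n. 0 < \<delta> n \<and> \<delta> n \<le> (1/2) ^ n) \<and> (\<forall>n. \<delta> (Suc n) \<le> \<delta> n) \<and>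
    (\<forall>n. \<forall>p\<in>carrier V. \<forall>q\<in>carrier V. \<forall>r\<in>carrier V.
      dist (\<nu> (p \<ominus> q)) eps0 < \<delta> (Suc n) \<longrightarrow> dist (\<nu> (q \<ominus> r)) eps0 < \<delta> (Suc n) \<longrightarrow>
      dist (\<nu> (p \<ominus> r)) eps0 < \<delta> n)"
proof -
  let ?Q = "\<lambda>(n::nat) x y. y \<le> x \<and> (\<forall>p\<in>carrier V. \<forall>q\<in>carrier V. \<forall>r\<in>carrier V.
      dist (\<nu> (p \<ominus> q)) eps0 < y \<longrightarrow> dist (\<nu> (q \<ominus> r)) eps0 < y \<longrightarrow> dist (\<nu> (p \<ominus> r)) eps0 < x)"
  have "\<exists>\<delta>. \<forall>n. (0 < \<delta> n \<and> \<delta> n \<le> (1/2) ^ n) \<and> ?Q n (\<delta> n) (\<delta> (Suc n))"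
  proof (rule dependent_nat_choice)
    show "\<exists>x. 0 < x \<and> x \<le> (1/2 :: real) ^ 0" by (intro exI[of _ 1]) auto
  next
    fix x :: real and n :: nat assume x: "0 < x \<and> x \<le> (1/2) ^ n"
    obtain d where d: "d > 0" "\<forall>p\<in>carrier V. \<forall>q\<in>carrier V. \<forall>r\<in>carrier V.
      dist (\<nu> (p \<ominus> q)) eps0 < d \<longrightarrow> dist (\<nu> (q \<ominus> r)) eps0 < d \<longrightarrow> dist (\<nu> (p \<ominus> r)) eps0 < x"
      using dist_norm_triangle x by blast
    \<comment> \<open>The bound \<open>d\<close> gives the combination property, \<open>x/2\<close>
      both the decrease and the geometric bound.\<close>
    show "\<exists>y. (0 < y \<and> y \<le> (1/2) ^ Suc n) \<and> ?Q n x y"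
      by (intro exI[of _ "min d (x/2)"]) (use d x in auto)
  qed
  then show ?thesis by blast
qed

text \<open>Replaces the summation of a geometric series: however many steps follow index
  \<open>n\<close>, the total displacement stays below \<open>\<delta> n\<close>.\<close>

lemma strong_Cauchy_of_steps:
  assumes p: "\<And>n. p n \<in> carrier V"
    and \<delta>: "\<And>n. 0 < \<delta> n" "\<And>n. \<delta> n \<le> (1/2) ^ n" "\<And>n. \<delta> (Suc n) \<le> \<delta> n"
    and tri: "\<And>n p q r. \<lbrakk>p \<in> carrier V; q \<in> carrier V; r \<in> carrier V;
      dist (\<nu> (p \<ominus> q)) eps0 < \<delta> (Suc n); dist (\<nu> (q \<ominus> r)) eps0 < \<delta> (Suc n)\<rbrakk>
      \<Longrightarrow> dist (\<nu> (p \<ominus> r)) eps0 < \<delta> n"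
    and step: "\<And>n. dist (\<nu> (p (Suc n) \<ominus> p n)) eps0 < \<delta> (Suc n)"
  shows "strong_Cauchy V \<nu> p"
proof -
  \<comment> \<open>Induction for all \<open>n\<close> at once: the hypothesis at
    \<open>Suc n\<close> bounds the stretch starting there, the first step bounds the rest, both by
    \<open>\<delta> (Suc n)\<close>, so \<open>tri\<close> combines them to
    \<open>\<delta> n\<close>.\<close>
  have tail: "dist (\<nu> (p (n + j) \<ominus> p n)) eps0 < \<delta> n" for n j
  proof (induction j arbitrary: n)
    case 0
    have "p n \<ominus> p n = \<zero>" using p by (simp add: a_minus_def M.r_neg)
    then show ?case using \<delta>(1) N1[of \<zero>] by simp
  next
    case (Suc j)
    show ?case
      using tri[OF p p p Suc.IH[of "Suc n"] step] by simp
  qed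
  have tail_le: "dist (\<nu> (p m \<ominus> p n)) eps0 < \<delta> n" if "n \<le> m" for m n
    using tail[of n "m - n"] that by simp
  show ?thesis
    unfolding strong_Cauchy_iff_dist
  proof (intro allI impI)
    fix l :: real assume "l > 0"
    then obtain N where N: "(1/2 :: real) ^ N < l"
      using real_arch_pow_inv[of l "1/2"] by auto
    have "decseq \<delta>" using \<delta>(3) by (rule decseq_SucI)
    then have small: "\<delta> n < l" if "N \<le> n" for n
      using decseqD[of \<delta> N n] that \<delta>(2)[of N] N by simp
    have less: "dist (\<nu> (p m \<ominus> p n)) eps0 < l" if "n \<le> m" "N \<le> n" for m n
      using tail_le[OF that(1)] small[OF that(2)] by simp
    have "dist (\<nu> (p n \<ominus> p m)) eps0 < l" if "m > N" "n > N" for m n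
      using less[of m n] less[of n m] that norm_minus_commute[OF p p, of n m]
      by (cases "m \<le> n") auto
    then show "\<exists>N. \<forall>m n. m > N \<and> n > N \<longrightarrow> dist (\<nu> (p n \<ominus> p m)) eps0 < l" by blast
  qed
qed

end

section \<open>The quotient as a linear space of cosets\<close>

locale pn_space_subspace = pn_space +
  fixes W
  assumes subspace: "submodule W real_field V"
begin

sublocale W: abelian_subgroup W V
  using subspace M.abelian_group_axioms
  by (intro abelian_subgroupI3) (auto simp: additive_subgroup_def submodule_def)

abbreviation Q where "Q \<equiv> quotient_space V W"

lemma carrier_quotient: "carrier Q = (\<lambda>p. W +> p) ` carrier V"
  by (auto simp: quotient_space_def A_RCOSETS_def')

lemma coset_in_carrier: "p \<in> carrier V \<Longrightarrow> W +> p \<in> carrier Q"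
  by (simp add: carrier_quotient)

lemma coset_elem_carrier: "x \<in> W +> p \<Longrightarrow> p \<in> carrier V \<Longrightarrow> x \<in> carrier V"
  using a_r_coset_subset_G W.a_subset by blast

lemma coset_eq: "x \<in> W +> p \<Longrightarrow> p \<in> carrier V \<Longrightarrow> W +> x = W +> p"
  using W.a_repr_independence' by simp

lemma add_coset: "p \<in> carrier V \<Longrightarrow> q \<in> carrier V \<Longrightarrow> (W +> p) \<oplus>\<^bsub>Q\<^esub> (W +> q) = W +> (p \<oplus> q)"
  using W.a_rcos_sum by (simp add: quotient_space_def)

lemma zero_quotient: "\<zero>\<^bsub>Q\<^esub> = W"
  by (simp add: quotient_space_def)

lemma zero_coset: "W +> \<zero> = W"
  using W.a_subset by simp

lemma smult_coset: "p \<in> carrier V \<Longrightarrow> a \<odot>\<^bsub>Q\<^esub> (W +> p) = W +> (a \<odot> p)"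
  using smult_quotient_space[OF subspace] .

lemma scalar: "a \<in> carrier real_field"
  by (simp add: real_field_def)

lemma abelian_group_quotient: "abelian_group Q"
proof (rule abelian_groupI)
  fix P assume "P \<in> carrier Q"
  then obtain p where p: "p \<in> carrier V" "P = W +> p" by (auto simp: carrier_quotient)
  have "(W +> (\<ominus> p)) \<oplus>\<^bsub>Q\<^esub> P = \<zero>\<^bsub>Q\<^esub>"
    using p by (simp add: add_coset zero_quotient zero_coset M.l_neg)
  then show "\<exists>P'\<in>carrier Q. P' \<oplus>\<^bsub>Q\<^esub> P = \<zero>\<^bsub>Q\<^esub>"
    using p coset_in_carrier by blast
  \<comment> \<open>The zero of \<open>Q\<close> is written as a coset so that
    \<open>add_coset\<close> applies; the deleted simp rule would fold it back into
    \<open>W\<close>.\<close>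
  have "(W +> \<zero>) \<oplus>\<^bsub>Q\<^esub> P = P" using p by (simp add: add_coset del: M.a_coset_add_zero)
  then show "\<zero>\<^bsub>Q\<^esub> \<oplus>\<^bsub>Q\<^esub> P = P" by (simp add: zero_quotient zero_coset)
next
  show "\<zero>\<^bsub>Q\<^esub> \<in> carrier Q"
    using coset_in_carrier[of \<zero>] by (simp add: zero_quotient zero_coset)
qed (auto simp: carrier_quotient add_coset M.add.m_ac)

lemma module_quotient: "Module.module real_field Q"
  by (rule moduleI[OF R.is_cring abelian_group_quotient])
    (auto simp: carrier_quotient smult_coset add_coset scalar smult_l_distr smult_r_distr
      smult_assoc1)

sublocale Q: Module.module real_field Q
  by (rule module_quotient)

lemma uminus_coset: "p \<in> carrier V \<Longrightarrow> \<ominus>\<^bsub>Q\<^esub> (W +> p) = W +> (\<ominus> p)"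
  by (rule Q.M.minus_equality)
    (simp_all add: add_coset coset_in_carrier M.l_neg zero_quotient zero_coset)

lemma minus_coset:
  "p \<in> carrier V \<Longrightarrow> q \<in> carrier V \<Longrightarrow> (W +> p) \<ominus>\<^bsub>Q\<^esub> (W +> q) = W +> (p \<ominus> q)"
  by (simp add: a_minus_def uminus_coset add_coset)

section \<open>The quotient norm and its PN axioms\<close>

lemma norm_le_quotient_norm: "x \<in> P \<Longrightarrow> \<nu> x \<le> quotient_norm \<nu> P"
  by (simp add: quotient_norm_def le_Sup_ddf)

lemma quotient_norm_least:
  "p \<in> carrier V \<Longrightarrow> (\<And>x. x \<in> W +> p \<Longrightarrow> \<nu> x \<le> G) \<Longrightarrow> quotient_norm \<nu> (W +> p) \<le> G"
  unfolding quotient_norm_def using W.a_rcos_self by (intro Sup_ddf_least) auto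

lemma dist_quotient_norm_lessD:
  assumes "p \<in> carrier V" "dist (quotient_norm \<nu> (W +> p)) eps0 < t"
  shows "\<exists>x\<in>W +> p. dist (\<nu> x) eps0 < t"
  using dist_Sup_eps0_lessD[of "\<nu> ` (W +> p)"] assms W.a_rcos_self
  unfolding quotient_norm_def by auto

text \<open>A coset of norm \<open>eps0\<close> has members \<open>x = w \<oplus> p\<close> of norm
  arbitrarily near \<open>eps0\<close>, so the points \<open>\<ominus> w\<close> of \<open>W\<close>
  enter every neighbourhood of \<open>p\<close>, and closedness puts \<open>p\<close> in
  \<open>W\<close>. Conversely, \<open>W\<close> contains the null vector, and \<open>eps0\<close>
  is the greatest distribution function.\<close>

lemma quotient_norm_eq_eps0_iff:
  assumes closed: "closedin (strong_topology V \<nu>) W" and p: "p \<in> carrier V"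
  shows "quotient_norm \<nu> (W +> p) = eps0 \<longleftrightarrow> W +> p = W"
proof
  assume eps0: "quotient_norm \<nu> (W +> p) = eps0"
  have "p \<in> W"
  proof (rule ccontr)
    assume "p \<notin> W"
    then have "p \<in> carrier V - W" using p by simp
    then obtain t where t: "t > 0" "strong_nbhd V \<nu> p t \<subseteq> carrier V - W"
      using closed
      unfolding closedin_def topspace_strong_topology openin_strong_topology by blast
    obtain x where x: "x \<in> W +> p" "dist (\<nu> x) eps0 < t"
      using dist_quotient_norm_lessD[OF p, of t] eps0 t(1) by auto
    obtain w where w: "w \<in> W" "x = w \<oplus> p" using x(1) by (auto simp: a_r_coset_def')
    have "(\<ominus> w) \<ominus> p = \<ominus> x" using w p by (simp add: a_minus_def M.minus_add)
    then have "\<ominus> w \<in> strong_nbhd V \<nu> p t"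
      using x w p t(1) coset_elem_carrier by (simp add: mem_strong_nbhd_iff N2)
    then show False using t(2) w(1) by blast
  qed
  then show "W +> p = W" using M.a_coset_join2[OF p] W.a_subgroup by simp
next
  assume "W +> p = W"
  then have "\<nu> \<zero> \<le> quotient_norm \<nu> (W +> p)"
    by (intro norm_le_quotient_norm) simp
  then show "quotient_norm \<nu> (W +> p) = eps0"
    using N1[of \<zero>] by (simp add: antisym le_eps0)
qed

lemma pn_space_quotient:
  assumes "sup_continuous_tf \<tau>" "closedin (strong_topology V \<nu>) W"
  shows "pn_space Q (quotient_norm \<nu>) \<tau> \<tau>s"
proof
  show "continuous_triangle_function \<tau>" "continuous_triangle_function \<tau>s"
    by (rule tau, rule taus)
  show "\<tau> F G \<le> \<tau>s F G" for F G by (rule tau_le_taus)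
next
  fix P assume "P \<in> carrier Q"
  then obtain p where p: "p \<in> carrier V" "P = W +> p" by (auto simp: carrier_quotient)
  show "quotient_norm \<nu> P = eps0 \<longleftrightarrow> P = \<zero>\<^bsub>Q\<^esub>"
    using quotient_norm_eq_eps0_iff[OF assms(2) p(1)] p by (simp add: zero_quotient)
  \<comment> \<open>For N2, one inequality for all \<open>p\<close> suffices: applied to
    \<open>\<ominus> p\<close> it gives the reverse one.\<close>
  have le: "quotient_norm \<nu> (W +> p) \<le> quotient_norm \<nu> (W +> (\<ominus> p))" if p: "p \<in> carrier V" for p
  proof (rule quotient_norm_least[OF p])
    fix x assume x: "x \<in> W +> p"
    have xV: "x \<in> carrier V" using coset_elem_carrier[OF x p] .
    have "\<ominus> x \<in> W +> (\<ominus> x)" using xV W.a_rcos_self by simp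
    moreover have "W +> (\<ominus> x) = W +> (\<ominus> p)"
      using coset_eq[OF x p] uminus_coset[OF p] uminus_coset[OF xV] by simp
    ultimately have "\<nu> (\<ominus> x) \<le> quotient_norm \<nu> (W +> (\<ominus> p))"
      by (simp add: norm_le_quotient_norm)
    then show "\<nu> x \<le> quotient_norm \<nu> (W +> (\<ominus> p))" using N2 xV by simp
  qed
  show "quotient_norm \<nu> (\<ominus>\<^bsub>Q\<^esub> P) = quotient_norm \<nu> P"
    using le[OF p(1)] le[of "\<ominus> p"] p by (simp add: uminus_coset antisym)
  fix \<alpha> :: real assume \<alpha>: "0 \<le> \<alpha>" "\<alpha> \<le> 1"
  show "quotient_norm \<nu> P \<le>
      \<tau>s (quotient_norm \<nu> (\<alpha> \<odot>\<^bsub>Q\<^esub> P)) (quotient_norm \<nu> ((1 - \<alpha>) \<odot>\<^bsub>Q\<^esub> P))"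
    unfolding p(2)
  proof (rule quotient_norm_least[OF p(1)])
    fix x assume x: "x \<in> W +> p"
    have xV: "x \<in> carrier V" using coset_elem_carrier[OF x p(1)] .
    \<comment> \<open>Any member \<open>x\<close> may serve as representative, so its multiples lie
      in the scaled cosets; N4 for \<open>x\<close> and monotonicity of \<open>\<tau>s\<close> then
      bound \<open>\<nu> x\<close>.\<close>
    have le: "\<nu> (a \<odot> x) \<le> quotient_norm \<nu> (a \<odot>\<^bsub>Q\<^esub> (W +> p))" for a
    proof (rule norm_le_quotient_norm)
      have "a \<odot> x \<in> W +> (a \<odot> x)" using xV W.a_rcos_self scalar by simp
      then show "a \<odot> x \<in> a \<odot>\<^bsub>Q\<^esub> (W +> p)"
        using coset_eq[OF x p(1)] smult_coset[OF xV, of a] by simp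
    qed
    have "triangle_function \<tau>s" using taus by (simp add: continuous_triangle_function_def)
    then have mono: "\<tau>s F G \<le> \<tau>s F' G'" if "F \<le> F'" "G \<le> G'" for F F' G G'
      using that unfolding triangle_function_def by (meson order.trans)
    show "\<nu> x \<le> \<tau>s (quotient_norm \<nu> (\<alpha> \<odot>\<^bsub>Q\<^esub> (W +> p)))
        (quotient_norm \<nu> ((1 - \<alpha>) \<odot>\<^bsub>Q\<^esub> (W +> p)))"
      using order.trans[OF N4[OF xV \<alpha>] mono[OF le le]] .
  qed
next
  fix P P' assume "P \<in> carrier Q" "P' \<in> carrier Q"
  then obtain p p' where p: "p \<in> carrier V" "P = W +> p" "p' \<in> carrier V" "P' = W +> p'"
    by (auto simp: carrier_quotient)
  have tf: "triangle_function \<tau>" using tau by (simp add: continuous_triangle_function_def)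
  have ne: "\<nu> ` P \<noteq> {}" "\<nu> ` P' \<noteq> {}" using p W.a_rcos_self by blast+
  \<comment> \<open>N3 is first shown for single members, whose sum lies in the sum of the cosets;
    sup-continuity then passes to the suprema.\<close>
  have le: "\<tau> (\<nu> x) (\<nu> y) \<le> quotient_norm \<nu> (P \<oplus>\<^bsub>Q\<^esub> P')" if "x \<in> P" "y \<in> P'" for x y
  proof -
    have "x \<in> carrier V" "y \<in> carrier V" using that p coset_elem_carrier by auto
    then have "\<tau> (\<nu> x) (\<nu> y) \<le> \<nu> (x \<oplus> y)" by (rule N3)
    moreover have "x \<oplus> y \<in> P \<oplus>\<^bsub>Q\<^esub> P'"
      using that by (auto simp: quotient_space_def set_add_def')
    ultimately show ?thesis by (blast intro: order.trans norm_le_quotient_norm)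
  qed
  show "\<tau> (quotient_norm \<nu> P) (quotient_norm \<nu> P') \<le> quotient_norm \<nu> (P \<oplus>\<^bsub>Q\<^esub> P')"
    unfolding quotient_norm_def[of \<nu> P] quotient_norm_def[of \<nu> P']
    by (rule sup_continuous_tf_le[OF tf assms(1) ne]) (use le in blast)
qed

section \<open>Passing sequences between the quotient and \<open>V\<close>\<close>

lemma lift_quotient_sequence:
  assumes "range s \<subseteq> carrier Q"
    and step: "\<And>n. dist (quotient_norm \<nu> (s (Suc n) \<ominus>\<^bsub>Q\<^esub> s n)) eps0 < \<delta> n"
  shows "\<exists>p. \<forall>n. (p n \<in> carrier V \<and> W +> p n = s n) \<and> dist (\<nu> (p (Suc n) \<ominus> p n)) eps0 < \<delta> n"
proof (rule dependent_nat_choice)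
  have rep: "\<exists>q\<in>carrier V. s n = W +> q" for n
    using assms(1) by (auto simp: carrier_quotient)
  show "\<exists>x. x \<in> carrier V \<and> W +> x = s 0" using rep[of 0] by auto
  fix x n assume x: "x \<in> carrier V \<and> W +> x = s n"
  obtain q where q: "q \<in> carrier V" "s (Suc n) = W +> q" using rep by blast
  \<comment> \<open>The arbitrary representative \<open>q\<close> need not be near \<open>x\<close>.
    It is replaced by \<open>r \<oplus> x\<close>, where \<open>r\<close> is a member of the
    difference coset whose norm is within \<open>\<delta> n\<close> of \<open>eps0\<close>.\<close>
  have "s (Suc n) \<ominus>\<^bsub>Q\<^esub> s n = W +> (q \<ominus> x)" using minus_coset[of q x] q x by simp
  then obtain r where r: "r \<in> W +> (q \<ominus> x)" "dist (\<nu> r) eps0 < \<delta> n"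
    using dist_quotient_norm_lessD[of "q \<ominus> x" "\<delta> n"] step[of n] q x by auto
  have rV: "r \<in> carrier V" using coset_elem_carrier[OF r(1)] q x by simp
  have "W +> (r \<oplus> x) = (W +> r) \<oplus>\<^bsub>Q\<^esub> (W +> x)" using add_coset[of r x] rV x by simp
  also have "\<dots> = W +> ((q \<ominus> x) \<oplus> x)" using coset_eq[OF r(1)] add_coset[of "q \<ominus> x" x] q x by simp
  also have "(q \<ominus> x) \<oplus> x = q" using q x by (simp add: a_minus_def M.a_assoc M.l_neg)
  finally have "W +> (r \<oplus> x) = s (Suc n)" using q by simp
  moreover have "(r \<oplus> x) \<ominus> x = r" using rV x by (simp add: a_minus_def M.a_assoc M.r_neg)
  ultimately show "\<exists>y. (y \<in> carrier V \<and> W +> y = s (Suc n)) \<and> dist (\<nu> (y \<ominus> x)) eps0 < \<delta> n"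
    using rV x r(2) by (intro exI[of _ "r \<oplus> x"]) simp
qed

text \<open>The projection is a contraction in this sense: the quotient norm dominates the norm of
  each member, hence is at least as near to \<open>eps0\<close>.\<close>

lemma strongly_convergent_to_coset:
  assumes "range p \<subseteq> carrier V" "x \<in> carrier V" "strongly_convergent_to V \<nu> p x"
  shows "strongly_convergent_to Q (quotient_norm \<nu>) (\<lambda>n. W +> p n) (W +> x)"
  unfolding strongly_convergent_to_def
proof (intro allI impI)
  fix l :: real assume l: "l > 0"
  obtain N where N: "\<And>n. n \<ge> N \<Longrightarrow> p n \<in> strong_nbhd V \<nu> x l"
    using assms(3) l unfolding strongly_convergent_to_def by blast
  show "\<exists>N. \<forall>n\<ge>N. W +> p n \<in> strong_nbhd Q (quotient_norm \<nu>) (W +> x) l"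
  proof (intro exI[of _ N] allI impI)
    fix n assume "n \<ge> N"
    then have near: "dist (\<nu> (p n \<ominus> x)) eps0 < l" using N l by (simp add: mem_strong_nbhd_iff)
    have pV: "p n \<in> carrier V" using assms(1) by auto
    have "\<nu> (p n \<ominus> x) \<le> quotient_norm \<nu> (W +> (p n \<ominus> x))"
      using pV assms(2) by (intro norm_le_quotient_norm W.a_rcos_self) simp
    then have "dist (quotient_norm \<nu> (W +> (p n \<ominus> x))) eps0 < l"
      using dist_eps0_antimono near by (blast intro: le_less_trans)
    then show "W +> p n \<in> strong_nbhd Q (quotient_norm \<nu>) (W +> x) l"
      using l pV assms(2) by (simp add: mem_strong_nbhd_iff minus_coset coset_in_carrier)
  qed
qed

end

theorem theorem4p2:
  fixes V :: "(real, 'v, 'm) module_scheme" and \<nu> :: "'v \<Rightarrow> ddf"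
    and \<tau> \<tau>s :: "ddf \<Rightarrow> ddf \<Rightarrow> ddf" and W :: "'v set"
  assumes "pnb_space V \<nu> \<tau> \<tau>s"
    and "sup_continuous_tf \<tau>" and "sup_continuous_tf \<tau>s"
    and "submodule W real_field V"
    and "closedin (strong_topology V \<nu>) W"
  shows "pnb_space (quotient_space V W) (quotient_norm \<nu>) \<tau> \<tau>s"
proof -
  interpret pnb_space V \<nu> \<tau> \<tau>s by (rule assms(1))
  interpret pn_space_subspace V \<nu> \<tau> \<tau>s W
    by (intro pn_space_subspace.intro pn_space_subspace_axioms.intro pn_space_axioms assms(4))
  \<comment> \<open>Makes the subsequence criterion available in the quotient itself.\<close>
  interpret QN: pn_space Q "quotient_norm \<nu>" \<tau> \<tau>s
    using pn_space_quotient assms by blast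
  have "\<exists>P\<in>carrier Q. strongly_convergent_to Q (quotient_norm \<nu>) s P"
    if s: "range s \<subseteq> carrier Q" and Cauchy: "strong_Cauchy Q (quotient_norm \<nu>) s" for s
  proof -
    obtain \<delta> where \<delta>: "\<And>n. 0 < \<delta> n" "\<And>n. \<delta> n \<le> (1/2) ^ n" "\<And>n. \<delta> (Suc n) \<le> \<delta> n"
      and tri: "\<And>n p q r. \<lbrakk>p \<in> carrier V; q \<in> carrier V; r \<in> carrier V;
        dist (\<nu> (p \<ominus>\<^bsub>V\<^esub> q)) eps0 < \<delta> (Suc n); dist (\<nu> (q \<ominus>\<^bsub>V\<^esub> r)) eps0 < \<delta> (Suc n)\<rbrakk>
        \<Longrightarrow> dist (\<nu> (p \<ominus>\<^bsub>V\<^esub> r)) eps0 < \<delta> n"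
      using halving_radii by blast
    have "\<exists>N. \<forall>m n. m > N \<and> n > N \<longrightarrow> dist (quotient_norm \<nu> (s n \<ominus>\<^bsub>Q\<^esub> s m)) eps0 < \<delta> (Suc i)" for i
      using Cauchy \<delta>(1) unfolding strong_Cauchy_iff_dist by blast
    then obtain N where N: "\<And>i m n. m > N i \<Longrightarrow> n > N i \<Longrightarrow>
        dist (quotient_norm \<nu> (s n \<ominus>\<^bsub>Q\<^esub> s m)) eps0 < \<delta> (Suc i)"
      by metis
    \<comment> \<open>The sum and \<open>Suc\<close> put \<open>k i\<close> above
      \<open>N i\<close>, and the summand \<open>i\<close> makes \<open>k\<close> strictly
      increasing; hence \<open>k i\<close> and \<open>k (Suc i)\<close> both exceed
      \<open>N i\<close>.\<close>
    define k where "k i = Suc (i + (\<Sum>j\<le>i. N j))" for i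
    have k: "strict_mono k" by (rule strict_monoI_Suc) (simp add: k_def)
    have "N i < k i" for i
      using member_le_sum[of i "{..i}" N] by (simp add: k_def)
    moreover have "k i < k (Suc i)" for i using k by (simp add: strict_mono_Suc_iff)
    ultimately have "dist (quotient_norm \<nu> ((s \<circ> k) (Suc i) \<ominus>\<^bsub>Q\<^esub> (s \<circ> k) i)) eps0 < \<delta> (Suc i)" for i
      using N[of i "k i" "k (Suc i)"] less_trans[of "N i" "k i" "k (Suc i)"] by simp
    moreover have "range (s \<circ> k) \<subseteq> carrier Q" using s by auto
    ultimately obtain p where p: "\<And>n. p n \<in> carrier V" "\<And>n. W +>\<^bsub>V\<^esub> p n = (s \<circ> k) n"
      and step: "\<And>n. dist (\<nu> (p (Suc n) \<ominus>\<^bsub>V\<^esub> p n)) eps0 < \<delta> (Suc n)"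
      using lift_quotient_sequence[of "s \<circ> k" "\<lambda>n. \<delta> (Suc n)"] by blast
    have "strong_Cauchy V \<nu> p"
      using p(1) \<delta> tri step by (rule strong_Cauchy_of_steps)
    then obtain x where x: "x \<in> carrier V" "strongly_convergent_to V \<nu> p x"
      using strongly_complete[of p] p(1) by blast
    have "strongly_convergent_to Q (quotient_norm \<nu>) (s \<circ> k) (W +>\<^bsub>V\<^esub> x)"
      using strongly_convergent_to_coset[of p x] p x by (auto simp: image_subset_iff comp_def)
    \<comment> \<open>The limit is known along \<open>k\<close>; the Cauchy property extends it to
      all of \<open>s\<close>.\<close>
    then have "strongly_convergent_to Q (quotient_norm \<nu>) s (W +>\<^bsub>V\<^esub> x)"
      using QN.strong_Cauchy_subsequence_convergent[OF s Cauchy _ k] coset_in_carrier x(1) by blast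
    then show ?thesis using coset_in_carrier x(1) by blast
  qed
  then show ?thesis
    by unfold_locales blast
qed

end
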